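(* Let $D\ge 1$ be an integer, $k=D(D+1)/2$, and let $r\in\mathbb{R}$ with $1+rD\neq 0$. For each positive definite symmetric real $D\times D$ matrix $Q=(Q_{ab})$ let $e(Q)=(e^a_i(Q))$ be a (chosen) D-Bein of $Q$, and let $E(Q)$ be the $k\times k$ matrix with entries $E^{ab}_{ij}=\frac12(e^a_i e^b_j+e^a_j e^b_i)$, $a\le b$, $i\le j$. Then the Jacobian $$\mathcal{J}_r(Q)=[\det(Q)]^{\frac{k}{4(1+rD)}}\;|\det(E(Q))|$$ is constant (independent of $Q$) as $Q$ ranges over all positive definite symmetric $D\times D$ matrices if and only if $$r=\frac{D-4}{4D}.$$
   Context: A D-Bein of a positive definite symmetric $D\times D$ matrix $Q=(Q_{ab})$ is an invertible real matrix $e=(e^a_i)_{a,i=1,\dots,D}$ with inverse $(e^i_a)$ (so $e^i_a e^a_j=\delta^i_j$) such that $Q_{ab}=\delta_{ij}\,e^i_a e^j_b$. It is unique up to internal rotations; one fixes some choice $e=e(Q)$ for each $Q$. The rows of $E$ are labelled by index pairs $(a,b)$ with $1\le a\le b\le D$ and its columns by index pairs $(i,j)$ with $1\le i\le j\le D$. Both sets of pairs have $k=D(D+1)/2$ elements and are ordered in the same (lexicographic) way, so that $\det(E)$ is defined. Origin of the quantity: $\mathcal{J}_r(Q)$ is the Jacobian $|\det(\partial P/\partial\hat P)|$ associated, at fixed $Q$, with the linear change of momentum variables $P^{ab}=e^a_i e^b_j\,\hat P^{ij}\,[\det(Q)]^{\frac{1}{4(1+rD)}}$ between symmetric tensors $\hat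 P^{ij}$ and $P^{ab}$. Here $Q_{ab}=[\det(q)]^r q_{ab}$ is a conformally rescaled metric. *)

theory Defs
  imports Complex_Main "Jordan_Normal_Form.Determinant"
begin

text \<open>Indices run over 0, ..., D - 1 instead of 1, ..., D.\<close>

definition positive_definite_sym :: "nat \<Rightarrow> real mat \<Rightarrow> bool" where
  "positive_definite_sym D Q \<longleftrightarrow>
     Q \<in> carrier_mat D D \<and> transpose_mat Q = Q \<and>
     (\<forall>v \<in> carrier_vec D. v \<noteq> 0\<^sub>v D \<longrightarrow> v \<bullet> (Q *\<^sub>v v) > 0)"

text \<open>
  The bein is the matrix of the \<open>e\<^sup>a\<^sub>i\<close>, with upper index a as row and lower index i as column,
  that is \<open>e $$ (a, i)\<close>. Its inverse f is the matrix of the \<open>e\<^sup>i\<^sub>a\<close>, that is \<open>f $$ (i, a)\<close>.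
  It is f, not e, that factorises Q; the Kronecker delta in
  \<open>Q\<^sub>a\<^sub>b = \<delta>\<^sub>i\<^sub>j e\<^sup>i\<^sub>a e\<^sup>j\<^sub>b\<close> has been summed out.
\<close>

definition is_D_Bein :: "nat \<Rightarrow> real mat \<Rightarrow> real mat \<Rightarrow> bool" where
  "is_D_Bein D Q e \<longleftrightarrow>
     e \<in> carrier_mat D D \<and>
     (\<exists>f \<in> carrier_mat D D. inverts_mat e f \<and> inverts_mat f e \<and>
        (\<forall>a<D. \<forall>b<D. Q $$ (a, b) = (\<Sum>i<D. f $$ (i, a) * f $$ (i, b))))"

definition sym_dim :: "nat \<Rightarrow> nat" where
  "sym_dim D = D * (D + 1) div 2"

definition index_pairs :: "nat \<Rightarrow> (nat \<times> nat) list" where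
  "index_pairs D = [(a, b). a \<leftarrow> [0..<D], b \<leftarrow> [a..<D]]"

lemma set_index_pairs: "set (index_pairs D) = {(a, b). a \<le> b \<and> b < D}"
  by (fastforce simp: index_pairs_def)

lemma length_index_pairs: "length (index_pairs D) = sym_dim D"
proof -
  have "length (index_pairs D) = (\<Sum>a<D. D - a)"
    by (simp add: index_pairs_def length_concat comp_def interv_sum_list_conv_sum_set_nat
        atLeast0LessThan)
  also have "\<dots> = (\<Sum>i<D. Suc i)"
    by (subst sum.nat_diff_reindex[symmetric]) (auto intro!: sum.cong)
  also have "\<dots> = sym_dim D"
    unfolding sym_dim_def by (induction D) auto
  finally show ?thesis .
qed

definition E_mat :: "nat \<Rightarrow> real mat \<Rightarrow> real mat" where
  "E_mat D e = mat (sym_dim D) (sym_dim D) (\<lambda>(p, q).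
     let (a, b) = index_pairs D ! p; (i, j) = index_pairs D ! q
     in 1 / 2 * (e $$ (a, i) * e $$ (b, j) + e $$ (a, j) * e $$ (b, i)))"

definition bein_Jacobian :: "nat \<Rightarrow> real \<Rightarrow> (real mat \<Rightarrow> real mat) \<Rightarrow> real mat \<Rightarrow> real" where
  "bein_Jacobian D r e Q =
     det Q powr (real (sym_dim D) / (4 * (1 + r * real D))) * \<bar>det (E_mat D (e Q))\<bar>"

end

theory Submission
  imports Defs "Jordan_Normal_Form.Schur_Decomposition"
begin

text \<open>
  Up to a constant diagonal factor, \<open>E(Q)\<close> is the symmetric square of e, and the symmetric square
  is multiplicative. Over the complex numbers e is therefore similar to an upper triangular matrix
  without changing either determinant; in lexicographic order the symmetric square of an upper
  triangular matrix is again upper triangular, with diagonal entries \<open>e\<^sub>a\<^sub>a e\<^sub>b\<^sub>b\<close>, so its determinant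
  is \<open>det(e)\<close> to the power D + 1. As \<open>|det(e)|\<close> is \<open>det(Q)\<close> to the power -1/2, the Jacobian is a
  positive constant times a power of \<open>det(Q)\<close>, and \<open>det(Q)\<close> is not constant. So the Jacobian is
  constant iff the exponent vanishes, that is iff \<open>1 + rD = D/4\<close>.
\<close>

section \<open>Sums and products over lexicographically ordered index pairs\<close>

lemma sorted_index_pairs:
  "sorted_wrt (\<lambda>x y. fst x < fst y \<or> fst x = fst y \<and> snd x < snd y) (index_pairs D)"
proof -
  \<comment> \<open>The outer bound \<open>n\<close> is separated from \<open>D\<close>, so that the
    induction extends the outer list while the inner ranges stay fixed.\<close>
  have "sorted_wrt (\<lambda>x y. fst x < fst y \<or> fst x = fst y \<and> snd x < snd y)
      (concat (map (\<lambda>a. map (Pair a) [a..<D]) [0..<n]))" for n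
    by (induction n) (auto simp: sorted_wrt_append sorted_wrt_map)
  then show ?thesis
    by (simp add: index_pairs_def)
qed

lemma distinct_index_pairs: "distinct (index_pairs D)"
  unfolding distinct_conv_nth
  using sorted_wrt_nth_less[OF sorted_index_pairs[of D]] by (metis less_irrefl nat_neq_iff)

lemma index_pairs_nth:
  assumes "p < sym_dim D" "index_pairs D ! p = (a, b)"
  shows "a \<le> b" "b < D"
  using nth_mem[of p "index_pairs D"] assms by (auto simp: length_index_pairs set_index_pairs)

lemma index_pairs_nth_less:
  assumes "p < q" "q < sym_dim D" "index_pairs D ! p = (a, b)" "index_pairs D ! q = (i, j)"
  shows "a < i \<or> a = i \<and> b < j"
  using sorted_wrt_nth_less[OF sorted_index_pairs[of D] assms(1)] assms
  by (simp add: length_index_pairs)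

lemma bij_betw_index_pairs:
  "bij_betw (\<lambda>p. index_pairs D ! p) {0..<sym_dim D} {(a, b). a \<le> b \<and> b < D}"
  by (rule bij_betw_nth)
    (auto simp: distinct_index_pairs length_index_pairs set_index_pairs)

lemma finite_le_pairs: "finite {(a::nat, b). a \<le> b \<and> b < D}"
  using bij_betw_finite[OF bij_betw_index_pairs] by simp

text \<open>The square is the closed upper triangle together with the mirror image of the strict
  one, so each off-diagonal pair collects two terms.\<close>

lemma sum_square_eq_sum_le_pairs:
  fixes h :: "nat \<Rightarrow> nat \<Rightarrow> 'a::comm_monoid_add"
  shows "(\<Sum>i<D. \<Sum>j<D. h i j) =
    (\<Sum>(i, j)\<in>{(i, j). i \<le> j \<and> j < D}. if i = j then h i i else h i j + h j i)"
proof -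
  let ?L = "{(i, j). i \<le> j \<and> j < D}" and ?S = "{(i, j). i < j \<and> j < D}"
  have fin: "finite ?L" "finite ?S"
    using finite_le_pairs[of D] by (auto elim: rev_finite_subset)
  have "(\<Sum>i<D. \<Sum>j<D. h i j) = (\<Sum>(i, j)\<in>{..<D} \<times> {..<D}. h i j)"
    by (rule sum.cartesian_product)
  also have "{..<D} \<times> {..<D} = ?L \<union> prod.swap ` ?S"
    by (auto simp: image_iff prod.swap_def)
  also have "(\<Sum>(i, j)\<in>\<dots>. h i j) =
      (\<Sum>(i, j)\<in>?L. h i j) + (\<Sum>(i, j)\<in>prod.swap ` ?S. h i j)"
    by (rule sum.union_disjoint) (use fin in auto)
  also have "(\<Sum>(i, j)\<in>prod.swap ` ?S. h i j) = (\<Sum>(i, j)\<in>?S. h j i)"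
    by (subst sum.reindex) (auto simp: inj_on_def case_prod_beta)
  also have "\<dots> = (\<Sum>(i, j)\<in>?L. if i = j then 0 else h j i)"
    using fin by (intro sum.mono_neutral_cong_left) (auto split: if_splits)
  also have "(\<Sum>(i, j)\<in>?L. h i j) + \<dots> =
      (\<Sum>(i, j)\<in>?L. if i = j then h i i else h i j + h j i)"
    by (simp flip: sum.distrib) (rule sum.cong, auto)
  finally show ?thesis .
qed

text \<open>An index \<open>c < D\<close> occurs \<open>D - c\<close> times as first and
  \<open>c + 1\<close> times as second component, hence \<open>D + 1\<close> times in all.\<close>

lemma prod_le_pairs:
  fixes x :: "nat \<Rightarrow> 'a::comm_semiring_1"
  shows "(\<Prod>(a, b)\<in>{(a, b). a \<le> b \<and> b < D}. x a * x b) = (\<Prod>a<D. x a) ^ (D + 1)"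
proof -
  have 1: "{(a, b). a \<le> b \<and> b < D} = Sigma {..<D} (\<lambda>a. {a..<D})"
    by auto
  have 2: "{(a, b). a \<le> b \<and> b < D} = prod.swap ` Sigma {..<D} (\<lambda>b. {..b})"
    by (auto simp: image_iff prod.swap_def)
  have "(\<Prod>(a, b)\<in>{(a, b). a \<le> b \<and> b < D}. x a * x b) =
      (\<Prod>(a, b)\<in>{(a, b). a \<le> b \<and> b < D}. x a) * (\<Prod>(a, b)\<in>{(a, b). a \<le> b \<and> b < D}. x b)"
    by (simp add: case_prod_beta prod.distrib)
  also have "(\<Prod>(a, b)\<in>{(a, b). a \<le> b \<and> b < D}. x a) = (\<Prod>a<D. x a ^ (D - a))"
    unfolding 1 by (subst prod.Sigma[symmetric]) auto
  also have "(\<Prod>(a, b)\<in>{(a, b). a \<le> b \<and> b < D}. x b) = (\<Prod>b<D. x b ^ (b + 1))"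
    unfolding 2 by (subst prod.reindex) (auto simp: inj_on_def case_prod_beta comp_def
      prod.Sigma[symmetric, where g = "\<lambda>b _. x b", unfolded case_prod_beta])
  also have "(\<Prod>a<D. x a ^ (D - a)) * (\<Prod>b<D. x b ^ (b + 1)) = (\<Prod>a<D. x a ^ (D + 1))"
    unfolding prod.distrib[symmetric] power_add[symmetric] by (rule prod.cong) auto
  finally show ?thesis
    by (simp only: prod_power_distrib)
qed

section \<open>The symmetric square and its determinant\<close>

text \<open>
  \<open>sym_square A\<close> is the matrix of the map on symmetric tensors induced by A, in the basis
  \<open>e\<^sub>i \<otimes> e\<^sub>j + e\<^sub>j \<otimes> e\<^sub>i\<close> for \<open>i < j\<close> and \<open>e\<^sub>i \<otimes> e\<^sub>i\<close>. Unlike \<open>E_mat\<close>, which differs from it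
  by the factors 1/2 in the columns with \<open>i < j\<close>, it is multiplicative.
\<close>

definition sym_coeff :: "'a::comm_ring_1 mat \<Rightarrow> nat \<times> nat \<Rightarrow> nat \<times> nat \<Rightarrow> 'a" where
  "sym_coeff A = (\<lambda>(a, b) (i, j). if i = j then A $$ (a, i) * A $$ (b, i)
     else A $$ (a, i) * A $$ (b, j) + A $$ (a, j) * A $$ (b, i))"

definition sym_square :: "'a::comm_ring_1 mat \<Rightarrow> 'a mat" where
  "sym_square A = mat (sym_dim (dim_row A)) (sym_dim (dim_row A))
     (\<lambda>(p, q). sym_coeff A (index_pairs (dim_row A) ! p) (index_pairs (dim_row A) ! q))"

lemma sym_square_carrier:
  "A \<in> carrier_mat n n \<Longrightarrow> sym_square A \<in> carrier_mat (sym_dim n) (sym_dim n)"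
  by (simp add: sym_square_def)

lemma index_sym_square:
  assumes "A \<in> carrier_mat n n" "p < sym_dim n" "q < sym_dim n"
  shows "sym_square A $$ (p, q) = sym_coeff A (index_pairs n ! p) (index_pairs n ! q)"
  using assms by (simp add: sym_square_def)

text \<open>Expanding the products gives a sum over all \<open>(i, j)\<close>. Since
  \<open>sym_coeff B (i, j) (k, l)\<close> is symmetric in \<open>i\<close> and \<open>j\<close>,
  folding this sum onto \<open>i \<le> j\<close> symmetrises the coefficients of
  \<open>A\<close>.\<close>

lemma sym_coeff_mult:
  fixes A B :: "'a::comm_ring_1 mat"
  assumes A: "A \<in> carrier_mat n n" and B: "B \<in> carrier_mat n n"
    and lt: "a < n" "b < n" "k < n" "l < n"
  shows "sym_coeff (A * B) (a, b) (k, l) =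
    (\<Sum>x\<in>{(i, j). i \<le> j \<and> j < n}. sym_coeff A (a, b) x * sym_coeff B x (k, l))"
proof -
  have m: "(A * B) $$ (c, d) = (\<Sum>i<n. A $$ (c, i) * B $$ (i, d))" if "c < n" "d < n" for c d
    using that A B by (simp add: scalar_prod_def atLeast0LessThan)
  have mm: "(A * B) $$ (a, c) * (A * B) $$ (b, d) =
      (\<Sum>i<n. \<Sum>j<n. A $$ (a, i) * A $$ (b, j) * (B $$ (i, c) * B $$ (j, d)))"
    if "c < n" "d < n" for c d
    using that lt by (simp add: m sum_product ac_simps)
  have "sym_coeff (A * B) (a, b) (k, l) =
      (\<Sum>i<n. \<Sum>j<n. A $$ (a, i) * A $$ (b, j) * sym_coeff B (i, j) (k, l))"
    using lt by (cases "k = l") (simp_all add: sym_coeff_def mm algebra_simps sum.distrib)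
  also have "\<dots> = (\<Sum>x\<in>{(i, j). i \<le> j \<and> j < n}. sym_coeff A (a, b) x * sym_coeff B x (k, l))"
    unfolding sum_square_eq_sum_le_pairs
    by (rule sum.cong) (auto simp: sym_coeff_def algebra_simps)
  finally show ?thesis .
qed

lemma sym_square_mult:
  fixes A B :: "'a::comm_ring_1 mat"
  assumes A: "A \<in> carrier_mat n n" and B: "B \<in> carrier_mat n n"
  shows "sym_square (A * B) = sym_square A * sym_square B"
proof (rule eq_matI)
  note AB = mult_carrier_mat[OF A B]
  note carr = sym_square_carrier[OF A] sym_square_carrier[OF B] sym_square_carrier[OF AB]
  fix p q
  assume "p < dim_row (sym_square A * sym_square B)" "q < dim_col (sym_square A * sym_square B)"
  then have pq: "p < sym_dim n" "q < sym_dim n"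
    using carr by auto
  obtain a b k l where ab: "index_pairs n ! p = (a, b)" and kl: "index_pairs n ! q = (k, l)"
    by (meson surj_pair)
  have "sym_square (A * B) $$ (p, q) =
      (\<Sum>x\<in>{(i, j). i \<le> j \<and> j < n}. sym_coeff A (a, b) x * sym_coeff B x (k, l))"
    using index_pairs_nth[OF pq(1) ab] index_pairs_nth[OF pq(2) kl] pq
    by (simp add: index_sym_square[OF AB] ab kl sym_coeff_mult[OF A B])
  also have "\<dots> = (\<Sum>s = 0..<sym_dim n. sym_square A $$ (p, s) * sym_square B $$ (s, q))"
    using pq by (subst sum.reindex_bij_betw[OF bij_betw_index_pairs, symmetric])
      (simp add: index_sym_square[OF A] index_sym_square[OF B] ab kl)
  finally show "sym_square (A * B) $$ (p, q) = (sym_square A * sym_square B) $$ (p, q)"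
    using pq carr by (simp add: scalar_prod_def)
qed (use A B in \<open>auto simp: sym_square_def\<close>)

lemma det_sym_square_upper_triangular:
  fixes A :: "'a::comm_ring_1 mat"
  assumes A: "A \<in> carrier_mat n n" and ut: "upper_triangular A"
  shows "det (sym_square A) = det A ^ (n + 1)"
proof -
  note carr = sym_square_carrier[OF A]
  have z: "A $$ (i, j) = 0" if "j < i" "i < n" for i j
    using upper_triangularD[OF ut] that A by auto
  have "upper_triangular (sym_square A)"
  proof (rule upper_triangularI)
    fix p q assume qp: "q < p" and "p < dim_row (sym_square A)"
    then have p: "p < sym_dim n" and q: "q < sym_dim n"
      using carr by auto
    obtain a b i j where ab: "index_pairs n ! p = (a, b)" and ij: "index_pairs n ! q = (i, j)"
      by (meson surj_pair)
    \<comment> \<open>If \<open>i < a\<close>, then also \<open>i < b\<close>, so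
      \<open>A $$ (a, i)\<close> and \<open>A $$ (b, i)\<close> vanish. If \<open>i = a\<close> and
      \<open>j < b\<close>, then \<open>A $$ (b, j)\<close> and \<open>A $$ (b, i)\<close> vanish.
      Either way every product contains a zero.\<close>
    show "sym_square A $$ (p, q) = 0"
      using index_pairs_nth[OF p ab] index_pairs_nth[OF q ij] index_pairs_nth_less[OF qp p ij ab]
      by (auto simp: index_sym_square[OF A p q] ab ij sym_coeff_def z)
  qed
  then have "det (sym_square A) = (\<Prod>p = 0..<sym_dim n. sym_square A $$ (p, p))"
    using carr by (simp add: det_upper_triangular prod_list_diag_prod)
  also have "\<dots> = (\<Prod>p = 0..<sym_dim n. sym_coeff A (index_pairs n ! p) (index_pairs n ! p))"
    by (rule prod.cong) (simp_all add: index_sym_square[OF A])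
  also have "\<dots> = (\<Prod>x\<in>{(a, b). a \<le> b \<and> b < n}. sym_coeff A x x)"
    by (rule prod.reindex_bij_betw[OF bij_betw_index_pairs])
  \<comment> \<open>For \<open>a < b\<close> the second summand contains \<open>A $$ (b, a)\<close>,
    which lies below the diagonal.\<close>
  also have "\<dots> = (\<Prod>(a, b)\<in>{(a, b). a \<le> b \<and> b < n}. A $$ (a, a) * A $$ (b, b))"
    by (rule prod.cong) (auto simp: sym_coeff_def z)
  also have "\<dots> = det A ^ (n + 1)"
    using A by (simp add: prod_le_pairs det_upper_triangular[OF ut A] prod_list_diag_prod
        atLeast0LessThan)
  finally show ?thesis .
qed

lemma det_sym_square_one: "det (sym_square (1\<^sub>m n :: 'a::comm_ring_1 mat)) = 1"
  using det_sym_square_upper_triangular[of "1\<^sub>m n :: 'a mat" n] by simp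

lemma det_sym_square_complex:
  fixes A :: "complex mat"
  assumes A: "A \<in> carrier_mat n n"
  shows "det (sym_square A) = det A ^ (n + 1)"
proof -
  \<comment> \<open>The Schur decomposition asks for a characteristic polynomial that splits into
    linear factors; this is where the complex field enters.\<close>
  obtain es where "char_poly A = (\<Prod>a\<leftarrow>es. [:- a, 1:])"
    using char_poly_factorized[OF A] by blast
  from schur_decomposition_exists[OF A this]
  obtain B where B: "B \<in> carrier_mat n n" and ut: "upper_triangular B" and sim: "similar_mat A B"
    by blast
  from sim obtain P Q where "similar_mat_wit A B P Q"
    unfolding similar_mat_def by blast
  from similar_mat_witD2[OF A this]
  have PQ: "P * Q = 1\<^sub>m n" and AB: "A = P * B * Q"
    and P: "P \<in> carrier_mat n n" and Q: "Q \<in> carrier_mat n n"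
    by auto
  note carr = sym_square_carrier[OF P] sym_square_carrier[OF Q] sym_square_carrier[OF B]
  have one: "det (sym_square P) * det (sym_square Q) = 1"
    using det_mult[OF carr(1,2)] by (simp add: PQ det_sym_square_one flip: sym_square_mult[OF P Q])
  have "det (sym_square A) = det (sym_square P) * det (sym_square B) * det (sym_square Q)"
    unfolding AB sym_square_mult[OF mult_carrier_mat[OF P B] Q] sym_square_mult[OF P B]
    using carr by (simp add: det_mult[of _ "sym_dim n"] mult_carrier_mat[of _ "sym_dim n" "sym_dim n"])
  also have "\<dots> = det (sym_square B)"
    using one by (simp add: algebra_simps)
  also have "\<dots> = det B ^ (n + 1)"
    by (rule det_sym_square_upper_triangular[OF B ut])
  also have "det B = det A"
    using det_similar[OF sim] by simp
  finally show ?thesis .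
qed

text \<open>Entries of \<open>sym_square A\<close> and determinants are polynomial in the entries
  with integer coefficients, so both commute with the embedding into the complex numbers.\<close>

lemma det_sym_square_real:
  fixes A :: "real mat"
  assumes A: "A \<in> carrier_mat n n"
  shows "det (sym_square A) = det A ^ (n + 1)"
proof -
  have A': "map_mat complex_of_real A \<in> carrier_mat n n"
    using A by simp
  have "sym_square (map_mat complex_of_real A) = map_mat complex_of_real (sym_square A)"
  proof (rule eq_matI)
    fix p q
    assume "p < dim_row (map_mat complex_of_real (sym_square A))"
      "q < dim_col (map_mat complex_of_real (sym_square A))"
    then have pq: "p < sym_dim n" "q < sym_dim n"
      using sym_square_carrier[OF A] by auto
    obtain a b i j where ab: "index_pairs n ! p = (a, b)" and ij: "index_pairs n ! q = (i, j)"
      by (meson surj_pair)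
    show "sym_square (map_mat complex_of_real A) $$ (p, q) =
        map_mat complex_of_real (sym_square A) $$ (p, q)"
      using index_pairs_nth[OF pq(1) ab] index_pairs_nth[OF pq(2) ij] pq A sym_square_carrier[OF A]
      by (simp add: index_sym_square[OF A'] index_sym_square[OF A] ab ij sym_coeff_def)
  qed (use A in \<open>auto simp: sym_square_def\<close>)
  then have "complex_of_real (det (sym_square A)) = complex_of_real (det A ^ (n + 1))"
    using det_sym_square_complex[OF A'] by (simp add: of_real_hom.hom_det)
  then show ?thesis
    by (simp only: of_real_eq_iff)
qed

section \<open>Determinants of \<open>E_mat\<close> and of the bein\<close>

text \<open>Rescaling the columns of \<open>sym_square A\<close> gives \<open>E_mat D A\<close>. The
  factor \<open>w\<close> comes from the weights alone and is therefore the same for all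
  \<open>A\<close>.\<close>

lemma det_E_mat:
  obtains w where "w > 0"
    "\<And>A. A \<in> carrier_mat D D \<Longrightarrow> \<bar>det (E_mat D A)\<bar> = w * \<bar>det A\<bar> ^ (D + 1)"
proof
  let ?c = "\<lambda>q. case index_pairs D ! q of (i, j) \<Rightarrow> if i = j then 1 else (1 / 2 :: real)"
  let ?W = "mat_diag (sym_dim D) ?c"
  have "det ?W = (\<Prod>q = 0..<sym_dim D. ?c q)"
    by (subst det_upper_triangular[of _ "sym_dim D"]) (auto simp: prod_list_diag_prod mat_diag_def)
  then show "\<bar>det ?W\<bar> > 0"
    by (auto split: prod.splits)
  fix A :: "real mat" assume A: "A \<in> carrier_mat D D"
  have "E_mat D A = sym_square A * ?W"
    using A unfolding mat_diag_mult_right[OF sym_square_carrier[OF A]]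
    by (intro eq_matI)
      (auto simp: E_mat_def sym_square_def sym_coeff_def split: prod.splits)
  then have "det (E_mat D A) = det A ^ (D + 1) * det ?W"
    using sym_square_carrier[OF A]
    by (simp add: det_mult[of _ "sym_dim D"] det_sym_square_real[OF A])
  then show "\<bar>det (E_mat D A)\<bar> = \<bar>det ?W\<bar> * \<bar>det A\<bar> ^ (D + 1)"
    by (simp add: abs_mult power_abs)
qed

text \<open>With \<open>f\<close> the inverse of \<open>e\<close>, the bein equation reads
  \<open>Q = transpose_mat f * f\<close>, so \<open>det Q\<close> is the square of
  \<open>det f\<close>.\<close>

lemma det_D_Bein:
  assumes Q: "positive_definite_sym D Q" and e: "is_D_Bein D Q e"
  shows "det Q > 0" "\<bar>det e\<bar> = det Q powr (- 1 / 2)"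
proof -
  obtain f where e: "e \<in> carrier_mat D D" and f: "f \<in> carrier_mat D D" and "inverts_mat e f"
    and Qf: "\<forall>a<D. \<forall>b<D. Q $$ (a, b) = (\<Sum>i<D. f $$ (i, a) * f $$ (i, b))"
    using e unfolding is_D_Bein_def by blast
  then have "e * f = 1\<^sub>m D"
    by (simp add: inverts_mat_def)
  then have ef: "det e * det f = 1"
    using det_mult[OF e f] by simp
  have "Q = transpose_mat f * f"
    using Q f Qf unfolding positive_definite_sym_def
    by (intro eq_matI) (auto simp: scalar_prod_def atLeast0LessThan)
  then have dQ: "det Q = \<bar>det f\<bar>\<^sup>2"
    using f by (simp add: det_mult[of _ D] det_transpose power2_eq_square)
  have nz: "\<bar>det f\<bar> > 0"
    using ef by auto
  then show "det Q > 0"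
    by (simp add: dQ)
  have "det Q powr (- 1 / 2) = \<bar>det f\<bar> powr (- 1)"
    unfolding dQ using nz by (subst powr_realpow[symmetric]) (simp_all only: powr_powr, simp)
  also have "\<dots> = \<bar>det e\<bar>"
    using ef nz by (simp add: powr_minus_divide field_simps flip: abs_mult)
  finally show "\<bar>det e\<bar> = det Q powr (- 1 / 2)" ..
qed

section \<open>Constancy of the Jacobian\<close>

text \<open>These matrices serve as test metrics, with determinant \<open>c ^ D\<close>.\<close>

lemma positive_definite_sym_smult_one:
  assumes "c > 0"
  shows "positive_definite_sym D (c \<cdot>\<^sub>m 1\<^sub>m D)"
proof -
  have "v \<bullet> (c \<cdot>\<^sub>m 1\<^sub>m D *\<^sub>v v) > 0" if v: "v \<in> carrier_vec D" "v \<noteq> 0\<^sub>v D" for v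
  proof -
    have "c \<cdot>\<^sub>m 1\<^sub>m D *\<^sub>v v = c \<cdot>\<^sub>v v"
      using v by (intro eq_vecI) (auto simp: scalar_prod_def if_distrib if_distribR sum.delta cong: if_cong)
    moreover have "v \<bullet> v > 0"
      using conjugate_square_greater_0_vec[OF v(1)] v(2) by simp
    ultimately show ?thesis
      using v assms by simp
  qed
  then show ?thesis
    by (auto simp: positive_definite_sym_def intro!: eq_matI)
qed

theorem proposition2p1:
  fixes D :: nat and r :: real and e :: "real mat \<Rightarrow> real mat"
  assumes "D \<ge> 1"
    and "1 + r * real D \<noteq> 0"
    and "\<And>Q. positive_definite_sym D Q \<Longrightarrow> is_D_Bein D Q (e Q)"
  shows "(\<exists>c. \<forall>Q. positive_definite_sym D Q \<longrightarrow> bein_Jacobian D r e Q = c) \<longleftrightarrow>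
         r = (real D - 4) / (4 * real D)"
proof -
  \<comment> \<open>The total exponent of \<open>det Q\<close>: the explicit prefactor, plus
    \<open>-1/2\<close> from the bein taken \<open>D + 1\<close> times. The form \<open>+ -\<close>
    lets \<open>powr_add\<close> match.\<close>
  define \<alpha> where "\<alpha> = real (sym_dim D) / (4 * (1 + r * real D)) + - real (D + 1) / 2"
  obtain w where w: "w > 0"
    "\<And>A. A \<in> carrier_mat D D \<Longrightarrow> \<bar>det (E_mat D A)\<bar> = w * \<bar>det A\<bar> ^ (D + 1)"
    using det_E_mat by blast
  have J: "bein_Jacobian D r e Q = w * det Q powr \<alpha>" if Q: "positive_definite_sym D Q" for Q
  proof -
    have eQ: "e Q \<in> carrier_mat D D"
      using assms(3)[OF Q] by (simp add: is_D_Bein_def)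
    note det = det_D_Bein[OF Q assms(3)[OF Q]]
    have "\<bar>det (e Q)\<bar> ^ (D + 1) = \<bar>det (e Q)\<bar> powr real (D + 1)"
      using det by (intro powr_realpow[symmetric]) auto
    also have "\<dots> = det Q powr (- real (D + 1) / 2)"
      by (simp add: det(2) powr_powr diff_divide_distrib add_divide_distrib)
    finally have "bein_Jacobian D r e Q = w * (det Q powr
        (real (sym_dim D) / (4 * (1 + r * real D))) * det Q powr (- real (D + 1) / 2))"
      by (simp only: bein_Jacobian_def w(2)[OF eQ] mult_ac)
    then show ?thesis
      by (simp only: \<alpha>_def powr_add)
  qed
  have dim: "real (sym_dim D) = real D * (real D + 1) / 2"
    unfolding sym_dim_def by (subst real_of_nat_div) (auto simp: algebra_simps)
  have \<alpha>: "\<alpha> = (real D + 1) / 2 * (real D / (4 * (1 + r * real D)) - 1)"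
  proof -
    have "real D * (real D + 1) / 2 / (4 * x) + - real (D + 1) / 2 =
        (real D + 1) / 2 * (real D / (4 * x) - 1)" if "x \<noteq> 0" for x
      using that by (simp add: field_simps)
    then show ?thesis
      unfolding \<alpha>_def dim using assms(2) by blast
  qed
  have zero: "\<alpha> = 0 \<longleftrightarrow> r = (real D - 4) / (4 * real D)"
  proof -
    have "\<alpha> = 0 \<longleftrightarrow> real D / (4 * (1 + r * real D)) = 1"
      unfolding \<alpha> by simp
    also have "\<dots> \<longleftrightarrow> r = (real D - 4) / (4 * real D)"
      using assms(1,2) by (auto simp: field_simps)
    finally show ?thesis .
  qed
  have "\<alpha> = 0" if "\<forall>Q. positive_definite_sym D Q \<longrightarrow> bein_Jacobian D r e Q = c" for c
  proof -
    have "w * det (s \<cdot>\<^sub>m 1\<^sub>m D :: real mat) powr \<alpha> = c" if "s > 0" for s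
      using J that positive_definite_sym_smult_one[OF that, of D]
        \<open>\<forall>Q. positive_definite_sym D Q \<longrightarrow> bein_Jacobian D r e Q = c\<close> by auto
    \<comment> \<open>The test metrics have determinants \<open>1\<close> and \<open>2 ^ D\<close>,
      and \<open>w\<close> cancels. As \<open>D \<ge> 1\<close>, the base \<open>2 ^ D\<close>
      differs from \<open>1\<close>, which forces the exponent to vanish.\<close>
    from this[of 1] this[of 2] have "(2 ^ D) powr \<alpha> = (1::real)"
      using w(1) by simp
    then show ?thesis
      using assms(1) by (simp add: powr_eq_one_iff_gen)
  qed
  \<comment> \<open>Positivity of \<open>det Q\<close> matters here, because \<open>0 powr 0\<close>
    is \<open>0\<close>.\<close>
  moreover have "bein_Jacobian D r e Q = w" if "\<alpha> = 0" "positive_definite_sym D Q" for Q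
    using J that det_D_Bein(1)[OF that(2) assms(3)[OF that(2)]] by simp
  ultimately show ?thesis
    using zero by blast
qed

end
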